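(* Let $\{\alpha_k\}_{k\in\mathbb Z}$ be the generators of the Heisenberg algebra acting on the boson Fock space $\mathcal B$, satisfying $[\alpha_m,\alpha_n]=m\,\delta_{m,-n}$ for $m,n\in\mathbb Z$. Let $A=(A_{i,j})_{i,j\in\mathbb Z}$ be a complex matrix such that for every fixed $i$, $A_{i,j}=0$ for $j\ll0$, and set $\tilde\alpha_k=\sum_{i\in\mathbb Z}A_{k,i}\alpha_i$. Then $\{\tilde\alpha_i\}_{i\in\mathbb Z}$ satisfy the same relations, $[\tilde\alpha_m,\tilde\alpha_n]=m\,\delta_{m,-n}$ for all $m,n\in\mathbb Z$, if and only if $$APA^T=P,$$ where $P=(P_{i,j})_{i,j\in\mathbb Z}$ has entries $P_{i,j}=i\,\delta_{i,-j}$ and $(A^T)_{i,j}=A_{j,i}$.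
   Context: The Heisenberg algebra is the complex Lie algebra with basis $\{\alpha_k\}_{k\in\mathbb Z}\cup\{1\}$, with $1$ central and $[\alpha_m,\alpha_n]=m\delta_{m,-n}\cdot1$. It acts on $\mathcal B=\mathbb C[z,z^{-1}]\otimes\mathbb C[p_1,p_2,\dots]$ by $\alpha_k=\partial/\partial p_k$, $\alpha_{-k}=kp_k$ (multiplication) for $k\ge1$, $\alpha_0=a_0\cdot 1$ for a scalar $a_0$, and $1$ acts as the identity. For each $b\in\mathcal B$ one has $\alpha_k(b)=0$ for $k\gg0$, so the $\tilde\alpha_k$ are well-defined operators. The entries $(APA^T)_{k,m}=\sum_{i}A_{k,i}\,i\,A_{m,-i}$ are finite sums. *)

theory Defs
  imports Complex_Main "HOL-Library.Poly_Mapping" "HOL-Library.Product_Plus"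
begin

(* The boson Fock space C[z, 1/z] \<otimes> C[p_1, p_2, ...], as the monoid algebra over the complex
   numbers of the exponents (n, m) of the monomials z^n * (\<Prod>j. p_(j+1)^(m_j)).  Note the shift:
   position j of m holds the exponent of p_(j+1), so that there is no variable p_0. *)
type_synonym fock = "(int \<times> (nat \<Rightarrow>\<^sub>0 nat)) \<Rightarrow>\<^sub>0 complex"

definition cscale :: "complex \<Rightarrow> fock \<Rightarrow> fock" where
  "cscale c b = Poly_Mapping.map ((*) c) b"

(* The exponent of p_k, for k \<ge> 1. *)
definition pexp :: "nat \<Rightarrow> (nat \<Rightarrow>\<^sub>0 nat)" where
  "pexp k = Poly_Mapping.single (k - 1) 1"

definition pvar :: "nat \<Rightarrow> fock" where
  "pvar k = Poly_Mapping.single (0, pexp k) 1"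

(* The partial derivative with respect to p_k, for k \<ge> 1: the linear extension of
   z^n p^m \<mapsto> m_k z^n p^m / p_k.  The subtraction of exponents truncates only if the
   exponent of p_k is 0, and then the coefficient vanishes. *)
definition pderiv_p :: "nat \<Rightarrow> fock \<Rightarrow> fock" where
  "pderiv_p k b = (\<Sum>(n, m)\<in>Poly_Mapping.keys b.
     Poly_Mapping.single (n, m - pexp k)
       (of_nat (Poly_Mapping.lookup m (k - 1)) * Poly_Mapping.lookup b (n, m)))"

definition alpha :: "complex \<Rightarrow> int \<Rightarrow> fock \<Rightarrow> fock" where
  "alpha a0 k b =
     (if k > 0 then pderiv_p (nat k) b
      else if k < 0 then cscale (of_int (- k)) (pvar (nat (- k)) * b)
      else cscale a0 b)"

definition commutator :: "(fock \<Rightarrow> fock) \<Rightarrow> (fock \<Rightarrow> fock) \<Rightarrow> fock \<Rightarrow> fock" where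
  "commutator f g = (\<lambda>b. f (g b) - g (f b))"

definition heisenberg_relations :: "(int \<Rightarrow> fock \<Rightarrow> fock) \<Rightarrow> bool" where
  "heisenberg_relations x \<longleftrightarrow>
     (\<forall>m n. commutator (x m) (x n) = cscale (of_int m * (if m = - n then 1 else 0)))"

definition row_bounded_below :: "(int \<Rightarrow> int \<Rightarrow> complex) \<Rightarrow> bool" where
  "row_bounded_below A \<longleftrightarrow> (\<forall>i. \<exists>N. \<forall>j<N. A i j = 0)"

(* The unrestricted sum is Sum_any, which is the sum of the nonzero terms if there are only
   finitely many of them; see finite_alpha_tilde below. *)
definition alpha_tilde ::
    "complex \<Rightarrow> (int \<Rightarrow> int \<Rightarrow> complex) \<Rightarrow> int \<Rightarrow> fock \<Rightarrow> fock" where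
  "alpha_tilde a0 A k b = Sum_any (\<lambda>i. cscale (A k i) (alpha a0 i b))"

(* Products of matrices indexed by the integers, again with Sum_any; finite_mat_APAT shows that
   the sums in the product A P A^T are finite. *)
definition mat_mul ::
    "(int \<Rightarrow> int \<Rightarrow> complex) \<Rightarrow> (int \<Rightarrow> int \<Rightarrow> complex) \<Rightarrow> int \<Rightarrow> int \<Rightarrow> complex" where
  "mat_mul X Y = (\<lambda>i j. Sum_any (\<lambda>k. X i k * Y k j))"

definition mat_transpose :: "(int \<Rightarrow> int \<Rightarrow> complex) \<Rightarrow> int \<Rightarrow> int \<Rightarrow> complex" where
  "mat_transpose X = (\<lambda>i j. X j i)"

definition P_mat :: "int \<Rightarrow> int \<Rightarrow> complex" where
  "P_mat = (\<lambda>i j. of_int i * (if i = - j then 1 else 0))"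

lemma cscale_alt: "cscale c b = Poly_Mapping.single 0 c * b"
  by (simp add: cscale_def mult_map_scale_conv_mult)

lemma finite_mat_AP: "finite {i. A k i * P_mat i j \<noteq> 0}"
  by (rule finite_subset[of _ "{- j}"]) (auto simp: P_mat_def split: if_splits)

lemma mat_AP: "mat_mul A P_mat k j = A k (- j) * of_int (- j)"
proof -
  have eq: "(\<lambda>i. A k i * P_mat i j) = (\<lambda>i. if i = - j then A k (- j) * of_int (- j) else 0)"
    by (auto simp: P_mat_def)
  show ?thesis unfolding mat_mul_def eq by simp
qed

lemma finite_mat_APAT:
  assumes "row_bounded_below A"
  shows "finite {j. mat_mul A P_mat k j * mat_transpose A j m \<noteq> 0}"
proof -
  obtain N M where "\<forall>j<N. A k j = 0" "\<forall>j<M. A m j = 0"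
    using assms unfolding row_bounded_below_def by meson
  then have "{j. mat_mul A P_mat k j * mat_transpose A j m \<noteq> 0} \<subseteq> {M..- N}"
    by (force simp: mat_AP mat_transpose_def not_le)
  then show ?thesis by (rule finite_subset) simp
qed

lemma mat_APAT:
  "mat_mul (mat_mul A P_mat) (mat_transpose A) k m = Sum_any (\<lambda>i. A k i * of_int i * A m (- i))"
  unfolding mat_mul_def[of "mat_mul A P_mat"] mat_AP mat_transpose_def
  by (rule Sum_any.reindex_cong[of uminus]) (auto simp: fun_eq_iff intro: bij_uminus)

lemma finite_pexp_support:
  fixes m :: "nat \<Rightarrow>\<^sub>0 nat"
  shows "finite {k. 0 < k \<and> Poly_Mapping.lookup m (k - 1) \<noteq> 0}"
proof (rule finite_subset)
  show "{k. 0 < k \<and> Poly_Mapping.lookup m (k - 1) \<noteq> 0} \<subseteq> Suc ` Poly_Mapping.keys m"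
  proof
    fix k assume "k \<in> {k. 0 < k \<and> Poly_Mapping.lookup m (k - 1) \<noteq> 0}"
    then show "k \<in> Suc ` Poly_Mapping.keys m"
      by (intro image_eqI[of _ _ "k - 1"]) (auto simp: in_keys_iff)
  qed
qed simp

lemma finite_alpha_pos: "finite {k. 0 < k \<and> alpha a0 k b \<noteq> 0}"
proof -
  let ?S = "\<Union>x\<in>Poly_Mapping.keys b. {k. 0 < k \<and> Poly_Mapping.lookup (snd x) (k - 1) \<noteq> 0}"
  have "{k. 0 < k \<and> alpha a0 k b \<noteq> 0} \<subseteq> int ` ?S"
  proof
    fix k assume "k \<in> {k. 0 < k \<and> alpha a0 k b \<noteq> 0}"
    then have k: "0 < k" "pderiv_p (nat k) b \<noteq> 0" by (auto simp: alpha_def)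
    have "\<exists>x\<in>Poly_Mapping.keys b. Poly_Mapping.lookup (snd x) (nat k - 1) \<noteq> 0"
    proof (rule ccontr)
      assume "\<not> ?thesis"
      then have "pderiv_p (nat k) b = 0"
        unfolding pderiv_p_def by (intro sum.neutral) auto
      with k(2) show False by contradiction
    qed
    then have "nat k \<in> ?S" using k(1) by auto
    then show "k \<in> int ` ?S" using k(1) by (intro image_eqI[of _ _ "nat k"]) auto
  qed
  moreover have "finite (int ` ?S)"
    by (intro finite_imageI finite_UN_I finite_keys finite_pexp_support)
  ultimately show ?thesis by (rule finite_subset)
qed

lemma finite_alpha_tilde:
  assumes "row_bounded_below A"
  shows "finite {i. cscale (A k i) (alpha a0 i b) \<noteq> 0}"
proof -
  obtain N where N: "\<forall>j<N. A k j = 0" using assms unfolding row_bounded_below_def by meson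
  have "{i. cscale (A k i) (alpha a0 i b) \<noteq> 0} \<subseteq> {N..0} \<union> {i. 0 < i \<and> alpha a0 i b \<noteq> 0}"
    using N by (force simp: cscale_alt not_le)
  then show ?thesis by (rule finite_subset) (simp add: finite_alpha_pos)
qed

lemma lookup_cscale [simp]: "Poly_Mapping.lookup (cscale c b) x = c * Poly_Mapping.lookup b x"
  unfolding cscale_def by transfer (auto simp: when_def)

lemma lookup_pderiv_p:
  "Poly_Mapping.lookup (pderiv_p k b) (n, m) =
     of_nat (Poly_Mapping.lookup m (k - 1) + 1) * Poly_Mapping.lookup b (n, m + pexp k)"
    (is "_ = ?r")
proof -
  have eq: "Poly_Mapping.lookup (case x of (n, m) \<Rightarrow> Poly_Mapping.single (n, m - pexp k)
        (of_nat (Poly_Mapping.lookup m (k - 1)) * Poly_Mapping.lookup b (n, m))) (n, m) =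
      (if x = (n, m + pexp k) then ?r else 0)" for x
  proof (cases x)
    case (Pair n' m')
    show ?thesis
    proof (cases "Poly_Mapping.lookup m' (k - 1) = 0")
      case True
      then have "m' \<noteq> m + pexp k" by (auto simp: lookup_add pexp_def)
      then show ?thesis using True Pair by simp
    next
      case False
      have "m' - pexp k = m \<longleftrightarrow> m' = m + pexp k"
      proof
        assume "m' - pexp k = m"
        moreover have "m' - pexp k + pexp k = m'"
          using False by (intro poly_mapping_eqI)
            (auto simp: lookup_add lookup_minus pexp_def lookup_single when_def)
        ultimately show "m' = m + pexp k" by simp
      qed simp
      then show ?thesis using Pair
        by (auto simp: lookup_single when_def lookup_add pexp_def)
    qed
  qed
  show ?thesis
    unfolding pderiv_p_def lookup_sum eq by (simp add: sum.delta in_keys_iff)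
qed

lemma lookup_pvar_times:
  "Poly_Mapping.lookup (pvar k * b) (n, m) =
     (if Poly_Mapping.lookup m (k - 1) = 0 then 0 else Poly_Mapping.lookup b (n, m - pexp k))"
proof -
  have "Poly_Mapping.lookup (pvar k * b) (n, m) =
      Sum_any (\<lambda>q. Poly_Mapping.lookup b q when (n, m) = (0, pexp k) + q)"
    unfolding pvar_def lookup_mult lookup_single when_mult by simp
  also have "(\<lambda>q. Poly_Mapping.lookup b q when (n, m) = (0, pexp k) + q) =
      (\<lambda>q. (if Poly_Mapping.lookup m (k - 1) = 0 then 0 else Poly_Mapping.lookup b q)
             when q = (n, m - pexp k))"
  proof
    fix q :: "int \<times> (nat \<Rightarrow>\<^sub>0 nat)"
    show "(Poly_Mapping.lookup b q when (n, m) = (0, pexp k) + q) =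
      ((if Poly_Mapping.lookup m (k - 1) = 0 then 0 else Poly_Mapping.lookup b q)
             when q = (n, m - pexp k))"
    proof (cases "Poly_Mapping.lookup m (k - 1) = 0")
      case True
      then have "(n, m) \<noteq> (0, pexp k) + q" by (cases q) (auto simp: lookup_add pexp_def)
      then show ?thesis using True by simp
    next
      case False
      then have "pexp k + (m - pexp k) = m"
        by (intro poly_mapping_eqI)
           (auto simp: lookup_add lookup_minus pexp_def lookup_single when_def)
      then have "(n, m) = (0, pexp k) + q \<longleftrightarrow> q = (n, m - pexp k)"
        by (cases q) auto
      then show ?thesis using False by simp
    qed
  qed
  finally show ?thesis by simp
qed

lemma pderiv_p_pvar_times:
  assumes "0 < k" "0 < j"
  shows "pderiv_p k (pvar j * b) - pvar j * pderiv_p k b = (if k = j then b else 0)"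
proof (rule poly_mapping_eqI)
  fix x :: "int \<times> (nat \<Rightarrow>\<^sub>0 nat)"
  obtain n m where x: "x = (n, m)" by (cases x)
  show "Poly_Mapping.lookup (pderiv_p k (pvar j * b) - pvar j * pderiv_p k b) x =
      Poly_Mapping.lookup (if k = j then b else 0) x"
  proof (cases "k = j")
    case True
    have "m - pexp j + pexp j = m" if "Poly_Mapping.lookup m (j - 1) \<noteq> 0"
      using that by (intro poly_mapping_eqI)
           (auto simp: lookup_add lookup_minus pexp_def lookup_single when_def)
    then show ?thesis using True
      by (auto simp: x lookup_minus lookup_pderiv_p lookup_pvar_times)
         (auto simp: lookup_add lookup_minus pexp_def algebra_simps)
  next
    case False
    then have ne: "k - 1 \<noteq> j - 1" using assms by auto
    have "m - pexp j + pexp k = m + pexp k - pexp j"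
      using ne by (intro poly_mapping_eqI)
           (auto simp: lookup_add lookup_minus pexp_def lookup_single when_def)
    then show ?thesis using False ne
      by (auto simp: x lookup_minus lookup_pderiv_p lookup_pvar_times)
         (auto simp: lookup_add lookup_minus pexp_def lookup_single when_def)
  qed
qed

lemma pderiv_p_cscale: "pderiv_p k (cscale c b) = cscale c (pderiv_p k b)"
  by (rule poly_mapping_eqI) (metis (no_types, opaque_lifting) lookup_cscale lookup_pderiv_p
      mult.left_commute surj_pair)

lemma pderiv_p_commute: "pderiv_p k (pderiv_p j b) = pderiv_p j (pderiv_p k b)"
proof (rule poly_mapping_eqI)
  fix x :: "int \<times> (nat \<Rightarrow>\<^sub>0 nat)"
  obtain n m where x: "x = (n, m)" by (cases x)
  show "Poly_Mapping.lookup (pderiv_p k (pderiv_p j b)) x =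
      Poly_Mapping.lookup (pderiv_p j (pderiv_p k b)) x"
    by (cases "k - 1 = j - 1")
       (simp_all add: x lookup_pderiv_p lookup_add pexp_def lookup_single when_def ac_simps)
qed

lemma cscale_simps:
  "cscale c (b + b') = cscale c b + cscale c b'"
  "cscale c (b - b') = cscale c b - cscale c b'"
  "cscale c (x * b) = x * cscale c b"
  "cscale c 0 = 0" "cscale 0 b = 0"
  by (simp_all add: cscale_alt algebra_simps)

lemma cscale_cscale: "cscale c (cscale d b) = cscale d (cscale c b)"
  by (rule poly_mapping_eqI) simp

lemma commutator_alpha_pos_neg:
  assumes "0 < m" "n < 0"
  shows "alpha a0 m (alpha a0 n b) - alpha a0 n (alpha a0 m b) =
    cscale (of_int m * (if m = - n then 1 else 0)) b"
proof -
  have "alpha a0 m (alpha a0 n b) - alpha a0 n (alpha a0 m b) =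
      cscale (of_int (- n)) (pderiv_p (nat m) (pvar (nat (- n)) * b)
        - pvar (nat (- n)) * pderiv_p (nat m) b)"
    using assms by (simp add: alpha_def pderiv_p_cscale cscale_simps(2))
  also have "\<dots> = cscale (of_int (- n)) (if nat m = nat (- n) then b else 0)"
    using assms by (subst pderiv_p_pvar_times) auto
  also have "\<dots> = cscale (of_int m * (if m = - n then 1 else 0)) b"
    using assms by (auto simp: cscale_simps)
  finally show ?thesis .
qed

lemma heisenberg_relations_alpha: "heisenberg_relations (alpha a0)"
  unfolding heisenberg_relations_def commutator_def fun_eq_iff
proof (intro allI)
  fix m n :: int and b :: fock
  consider "0 < m" "n < 0" | "m < 0" "0 < n" | "0 < m" "0 < n" | "m < 0" "n < 0" | "m = 0" | "n = 0"
    by linarith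
  then show "alpha a0 m (alpha a0 n b) - alpha a0 n (alpha a0 m b) =
    cscale (of_int m * (if m = - n then 1 else 0)) b"
  proof cases
    case 1
    then show ?thesis by (rule commutator_alpha_pos_neg)
  next
    case 2
    have "alpha a0 m (alpha a0 n b) - alpha a0 n (alpha a0 m b) =
      - cscale (of_int n * (if n = - m then 1 else 0)) b"
      using commutator_alpha_pos_neg[OF 2(2,1), of a0 b] by (metis minus_diff_eq)
    also have "\<dots> = cscale (of_int m * (if m = - n then 1 else 0)) b"
      by (rule poly_mapping_eqI) auto
    finally show ?thesis .
  next
    case 3
    then show ?thesis by (auto simp: alpha_def pderiv_p_commute cscale_simps)
  next
    case 4
    then show ?thesis by (auto simp: alpha_def cscale_alt ac_simps)
  next
    case 5
    then show ?thesis
      by (auto simp: alpha_def pderiv_p_cscale cscale_simps cscale_cscale)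
  next
    case 6
    then show ?thesis
      by (auto simp: alpha_def pderiv_p_cscale cscale_simps cscale_cscale)
  qed
qed

end

(* For a fixed Fock vector b, both compositions of two operators alpha_tilde become double sums
   over one finite symmetric interval of indices, so the commutator can be computed termwise: it
   is multiplication by the corresponding entry of A P A^T. *)

theory Submission
  imports Defs
begin

lemma pderiv_p_add: "pderiv_p k (b + b') = pderiv_p k b + pderiv_p k b'"
  by (rule poly_mapping_eqI)
     (metis (no_types, opaque_lifting) distrib_left lookup_add lookup_pderiv_p surj_pair)

lemma alpha_add: "alpha a0 k (b + b') = alpha a0 k b + alpha a0 k b'"
  by (simp add: alpha_def pderiv_p_add cscale_simps algebra_simps)

lemma alpha_cscale: "alpha a0 k (cscale c b) = cscale c (alpha a0 k b)"
  by (simp add: alpha_def pderiv_p_cscale cscale_simps(3) cscale_cscale flip: cscale_simps(3))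

lemma alpha_zero [simp]: "alpha a0 k 0 = 0"
  using alpha_add[of a0 k 0 0] by simp

lemma alpha_sum: "alpha a0 k (sum f S) = (\<Sum>i\<in>S. alpha a0 k (f i))"
  by (induction S rule: infinite_finite_induct) (simp_all add: alpha_add)

lemma cscale_sum: "cscale c (sum f S) = (\<Sum>i\<in>S. cscale c (f i))"
  by (simp add: cscale_alt sum_distrib_left)

lemma sum_cscale: "(\<Sum>i\<in>S. cscale (f i) b) = cscale (sum f S) b"
  by (rule poly_mapping_eqI) (simp add: lookup_sum sum_distrib_right)

lemma cscale_cscale_mult: "cscale c (cscale d b) = cscale (c * d) b"
  by (rule poly_mapping_eqI) simp

text \<open>The constant monomial \<open>1\<close> detects the scalar through its coefficient at
  exponent \<open>0\<close>. This turns identities between scalar operators into identities between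
  matrix entries.\<close>

lemma cscale_inject: "cscale c = cscale d \<longleftrightarrow> c = d"
proof
  assume "cscale c = cscale d"
  then have "Poly_Mapping.lookup (cscale c 1) 0 = Poly_Mapping.lookup (cscale d 1) 0"
    by simp
  then show "c = d" by (simp add: lookup_one)
qed simp

lemma alpha_commutator:
  "alpha a0 m (alpha a0 n b) - alpha a0 n (alpha a0 m b) =
     cscale (of_int m * (if m = - n then 1 else 0)) b"
  using heisenberg_relations_alpha[of a0]
  unfolding heisenberg_relations_def commutator_def by (metis (no_types, lifting))

lemma alpha_eventually_zero: "\<exists>K. \<forall>k>K. alpha a0 k b = 0"
proof -
  obtain K where "\<And>k. k \<in> {k. 0 < k \<and> alpha a0 k b \<noteq> 0} \<Longrightarrow> k \<le> K"
    using bdd_above_finite[OF finite_alpha_pos[of a0 b]] unfolding bdd_above_def by blast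
  \<comment> \<open>The finite set bounding \<open>K\<close> contains only positive indices, so the
    bound is raised to at least 0.\<close>
  then have "\<forall>k>max 0 K. alpha a0 k b = 0" by fastforce
  then show ?thesis by blast
qed

text \<open>Any finite superset of the support may index the sum, so that different rows of
  \<open>A\<close> can share one range.\<close>

lemma alpha_tilde_eq_sum:
  assumes "finite S" "\<And>i. i \<notin> S \<Longrightarrow> A k i = 0 \<or> alpha a0 i b = 0"
  shows "alpha_tilde a0 A k b = (\<Sum>i\<in>S. cscale (A k i) (alpha a0 i b))"
  unfolding alpha_tilde_def
proof (rule Sum_any.expand_superset[OF assms(1)], rule subsetI, rule ccontr)
  fix i
  assume "i \<in> {i. cscale (A k i) (alpha a0 i b) \<noteq> 0}" "i \<notin> S"
  then show False using assms(2)[of i] by (auto simp: cscale_simps)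
qed

text \<open>The upper bound on the outer index needs only \<open>\<alpha>\<^sub>k b = 0\<close> for \<open>k > L\<close>: if \<open>i > L\<close>
  and \<open>j \<ge> - L\<close>, then \<open>i + j > 0\<close>, so \<open>\<alpha>\<^sub>i\<close> commutes with \<open>\<alpha>\<^sub>j\<close> and kills \<open>\<alpha>\<^sub>j b\<close>.\<close>

lemma alpha_tilde_comp:
  assumes A: "\<And>i. i < - L \<Longrightarrow> A k i = 0" "\<And>i. i < - L \<Longrightarrow> A l i = 0"
    and b: "\<And>i. i > L \<Longrightarrow> alpha a0 i b = 0"
  shows "alpha_tilde a0 A k (alpha_tilde a0 A l b) =
    (\<Sum>i\<in>{-L..L}. \<Sum>j\<in>{-L..L}. cscale (A k i * A l j) (alpha a0 i (alpha a0 j b)))"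
proof -
  have inner: "alpha_tilde a0 A l b = (\<Sum>j\<in>{-L..L}. cscale (A l j) (alpha a0 j b))"
    using A(2) b by (intro alpha_tilde_eq_sum) force+
  have zero: "alpha a0 i (alpha a0 j b) = 0" if "i > L" "j \<in> {-L..L}" for i j
    using alpha_commutator[of a0 i j b] b[OF that(1)] that by (auto simp: cscale_simps)
  have "alpha a0 i (alpha_tilde a0 A l b) = 0" if "i > L" for i
    unfolding inner alpha_sum alpha_cscale using zero[OF that]
    by (intro sum.neutral) (simp add: cscale_simps)
  then have "alpha_tilde a0 A k (alpha_tilde a0 A l b) =
      (\<Sum>i\<in>{-L..L}. cscale (A k i) (alpha a0 i (alpha_tilde a0 A l b)))"
    using A(1) by (intro alpha_tilde_eq_sum) force+
  then show ?thesis
    by (simp add: inner alpha_sum alpha_cscale cscale_sum cscale_cscale_mult)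
qed

lemma commutator_alpha_tilde:
  assumes "row_bounded_below A"
  shows "commutator (alpha_tilde a0 A k) (alpha_tilde a0 A l) =
    cscale (mat_mul (mat_mul A P_mat) (mat_transpose A) k l)"
proof
  fix b
  obtain N M where NM: "\<forall>j<N. A k j = 0" "\<forall>j<M. A l j = 0"
    using assms unfolding row_bounded_below_def by meson
  obtain K where K: "\<forall>k>K. alpha a0 k b = 0"
    using alpha_eventually_zero by blast
  \<comment> \<open>This \<open>L\<close> puts \<open>- L\<close> below both row bounds
    \<open>N\<close> and \<open>M\<close>, and \<open>L\<close> above the bound \<open>K\<close> for
    \<open>b\<close>.\<close>
  define L where "L = max K (max (- N) (- M))"
  let ?S = "{-L..L}"
  have Ak: "A k i = 0" and Al: "A l i = 0" if "i < - L" for i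
    using NM that by (auto simp: L_def)
  have b: "alpha a0 i b = 0" if "i > L" for i
    using K that by (auto simp: L_def)
  have comp:
    "alpha_tilde a0 A k (alpha_tilde a0 A l b) =
      (\<Sum>i\<in>?S. \<Sum>j\<in>?S. cscale (A k i * A l j) (alpha a0 i (alpha a0 j b)))"
    "alpha_tilde a0 A l (alpha_tilde a0 A k b) =
      (\<Sum>i\<in>?S. \<Sum>j\<in>?S. cscale (A l i * A k j) (alpha a0 i (alpha a0 j b)))"
    by (rule alpha_tilde_comp; fact Ak Al b)+
  \<comment> \<open>Swapping the two sums gives the reversed composition the same coefficients
    \<open>A k i * A l j\<close>, ready for termwise subtraction.\<close>
  have "alpha_tilde a0 A l (alpha_tilde a0 A k b) =
      (\<Sum>i\<in>?S. \<Sum>j\<in>?S. cscale (A k i * A l j) (alpha a0 j (alpha a0 i b)))"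
    unfolding comp(2) by (subst sum.swap) (simp add: mult.commute)
  then have "commutator (alpha_tilde a0 A k) (alpha_tilde a0 A l) b =
      (\<Sum>i\<in>?S. \<Sum>j\<in>?S. cscale (A k i * A l j)
        (alpha a0 i (alpha a0 j b) - alpha a0 j (alpha a0 i b)))"
    by (simp add: commutator_def comp(1) cscale_simps(2) sum_subtractf)
  also have "\<dots> = cscale (\<Sum>i\<in>?S. \<Sum>j\<in>?S.
      A k i * A l j * (of_int i * (if i = - j then 1 else 0))) b"
    by (simp only: alpha_commutator cscale_cscale_mult sum_cscale)
  also have "(\<Sum>i\<in>?S. \<Sum>j\<in>?S. A k i * A l j * (of_int i * (if i = - j then 1 else 0))) =
      (\<Sum>i\<in>?S. A k i * of_int i * A l (- i))"
  proof (rule sum.cong[OF refl])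
    \<comment> \<open>Only \<open>j = - i\<close> contributes, and it lies in the range because the
      interval is symmetric.\<close>
    fix i assume i: "i \<in> ?S"
    have "(\<Sum>j\<in>?S. A k i * A l j * (of_int i * (if i = - j then 1 else 0))) =
        (\<Sum>j\<in>?S. if j = - i then A k i * of_int i * A l (- i) else 0)"
      by (intro sum.cong) auto
    then show "(\<Sum>j\<in>?S. A k i * A l j * (of_int i * (if i = - j then 1 else 0))) =
        A k i * of_int i * A l (- i)"
      using i by (simp add: sum.delta)
  qed
  also have "\<dots> = mat_mul (mat_mul A P_mat) (mat_transpose A) k l"
    unfolding mat_APAT
  proof (rule Sum_any.expand_superset[symmetric])
    \<comment> \<open>Below \<open>- L\<close> the factor \<open>A k i\<close> vanishes; above
      \<open>L\<close>, the index \<open>- i\<close> is below \<open>- L\<close> and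
      \<open>A l (- i)\<close> vanishes.\<close>
    show "{i. A k i * of_int i * A l (- i) \<noteq> 0} \<subseteq> ?S"
      using Ak Al by (force simp: not_less[symmetric])
  qed simp
  finally show "commutator (alpha_tilde a0 A k) (alpha_tilde a0 A l) b =
      cscale (mat_mul (mat_mul A P_mat) (mat_transpose A) k l) b" .
qed

theorem proposition3p3:
  fixes a0 :: complex and A :: "int \<Rightarrow> int \<Rightarrow> complex"
  assumes "row_bounded_below A"
  shows "heisenberg_relations (alpha_tilde a0 A) \<longleftrightarrow>
         mat_mul (mat_mul A P_mat) (mat_transpose A) = P_mat"
  \<comment> \<open>Both sides of each relation are now scalar operators, and the scalar required
    for \<open>m\<close> and \<open>n\<close> is exactly the entry \<open>P_mat m n\<close>.\<close>
  unfolding heisenberg_relations_def commutator_alpha_tilde[OF assms] cscale_inject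
  by (simp add: P_mat_def fun_eq_iff)

end
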